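(* Let $m \geq 1$, $h \geq 2$ and $g \geq 2$ be integers. Each of the three functions $t \mapsto b_m[g](t)$, $t \mapsto b_m^-[g](t)$ and $t \mapsto b_{m,h}(t)$ (defined for positive integers $t$) is a quasipolynomial in $t$ of degree $m-1$ with leading coefficient $\frac{1}{(m-1)!}$.
   Context: A ruler of length $t$ with $m+1$ markings is a sequence of integers $0=x_0<x_1<\cdots<x_{m-1}<x_m=t$; the $x_i$ are its markings. The ruler is a $B_2[g]$-set if each positive integer admits at most $g$ representations as a sum of two markings. Here representations are unordered, and the two markings may be equal: a representation of $n$ is a pair of indices $i\le j$ with $x_i+x_j=n$. The ruler is a $B_2^-[g]$-set if each positive integer admits at most $g$ representations as a difference of two markings, a representation of $n$ being a pair $i<j$ with $x_j-x_i=n$. The ruler is a $B_h$-set if each positive integer admits at most one representation as a sum of $h$ markings. Equivalently, for every pair of distinct sequences $0\le r_1\le\cdots\le r_h\le m$ and $0\le s_1\le\cdots\le s_h\le m$ one has $x_{r_1}+\cdots+x_{r_h}\ne x_{s_1}+\cdots+x_{s_h}$. For a positive integer $t$, $b_m[g](t)$, $b_m^-[g](t)$ and $b_{m,h}(t)$ denote the numbers of rulers of length $t$ with $m+1$ markings that are respectively $B_2[g]$-sets, $B_2^-[g]$-sets and $B_h$-sets. A quasipolynomial of degree $d$ is a function of the form $t\mapsto c_d(t)t^d+\cdots+c_1(t)t+c_0(t)$, where each $c_i$ is a periodic function on the integers and $c_d$ is not identically zero. Saying that its leading coefficient is $c$ means that $c_d$ is constant, equal to $c$. *)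

theory Defs
  imports "HOL-Analysis.Analysis" "HOL-Library.Periodic_Fun"
begin

(* A ruler is the list of its markings [x_0, ..., x_m]. *)
definition ruler :: "nat \<Rightarrow> int \<Rightarrow> int list \<Rightarrow> bool" where
  "ruler m t xs \<longleftrightarrow>
     length xs = m + 1 \<and> xs ! 0 = 0 \<and> xs ! m = t \<and> sorted_wrt (<) xs"

definition B2_set :: "nat \<Rightarrow> int list \<Rightarrow> bool" where
  "B2_set g xs \<longleftrightarrow>
     (\<forall>n>0. card {(i, j). i \<le> j \<and> j < length xs \<and> xs ! i + xs ! j = n} \<le> g)"

definition B2_minus_set :: "nat \<Rightarrow> int list \<Rightarrow> bool" where
  "B2_minus_set g xs \<longleftrightarrow>
     (\<forall>n>0. card {(i, j). i < j \<and> j < length xs \<and> xs ! j - xs ! i = n} \<le> g)"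

(* An unordered sum of h markings, repetitions allowed, is given by the weakly
   increasing list r_1 \<le> ... \<le> r_h of the indices of its summands. *)
definition sum_representations :: "nat \<Rightarrow> int list \<Rightarrow> int \<Rightarrow> nat list set" where
  "sum_representations h xs n =
     {rs. length rs = h \<and> sorted rs \<and> set rs \<subseteq> {..<length xs} \<and> (\<Sum>r\<leftarrow>rs. xs ! r) = n}"

definition Bh_set :: "nat \<Rightarrow> int list \<Rightarrow> bool" where
  "Bh_set h xs \<longleftrightarrow> (\<forall>n>0. card (sum_representations h xs n) \<le> 1)"

definition b2 :: "nat \<Rightarrow> nat \<Rightarrow> int \<Rightarrow> nat" where
  "b2 m g t = card {xs. ruler m t xs \<and> B2_set g xs}"

definition b2_minus :: "nat \<Rightarrow> nat \<Rightarrow> int \<Rightarrow> nat" where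
  "b2_minus m g t = card {xs. ruler m t xs \<and> B2_minus_set g xs}"

definition bh :: "nat \<Rightarrow> nat \<Rightarrow> int \<Rightarrow> nat" where
  "bh m h t = card {xs. ruler m t xs \<and> Bh_set h xs}"

(* The cardinalities above are those of finite sets, so the convention that
   infinite sets have cardinality 0 plays no role. *)
lemma finite_rulers: "finite {xs. ruler m t xs}"
proof (rule finite_subset)
  show "{xs. ruler m t xs} \<subseteq> {xs. set xs \<subseteq> {0..t} \<and> length xs = m + 1}"
  proof safe
    fix xs x assume r: "ruler m t xs" and "x \<in> set xs"
    then obtain i where i: "i < length xs" "x = xs ! i" by (auto simp: in_set_conv_nth)
    have "sorted xs" using r by (simp add: ruler_def strict_sorted_iff)
    then have "xs ! 0 \<le> xs ! i" "xs ! i \<le> xs ! m"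
      using i r sorted_nth_mono[of xs 0 i] sorted_nth_mono[of xs i m]
      by (auto simp: ruler_def)
    then show "x \<in> {0..t}" using r i by (simp add: ruler_def)
  qed (simp add: ruler_def)
qed (rule finite_lists_length_eq, simp)

lemma finite_sum_representations: "finite (sum_representations h xs n)"
  by (rule finite_subset[OF _ finite_lists_length_eq[of "{..<length xs}" h]])
     (auto simp: sum_representations_def)

lemma finite_pair_sums: "finite {(i, j). i \<le> j \<and> j < length (xs :: int list) \<and> xs ! i + xs ! j = n}"
  by (rule finite_subset[of _ "{..<length xs} \<times> {..<length xs}"]) auto

lemma finite_pair_differences: "finite {(i, j). i < j \<and> j < length (xs :: int list) \<and> xs ! j - xs ! i = n}"
  by (rule finite_subset[of _ "{..<length xs} \<times> {..<length xs}"]) auto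

definition periodic :: "(int \<Rightarrow> real) \<Rightarrow> bool" where
  "periodic c \<longleftrightarrow> (\<exists>p>0. periodic_fun_simple c p)"

(* The functions considered are defined on the positive integers only, so the values
   f t with t \<le> 0 are irrelevant. *)
definition quasipolynomial_coeffs :: "nat \<Rightarrow> (nat \<Rightarrow> int \<Rightarrow> real) \<Rightarrow> (int \<Rightarrow> real) \<Rightarrow> bool" where
  "quasipolynomial_coeffs d c f \<longleftrightarrow>
     (\<forall>i\<le>d. periodic (c i)) \<and> (\<exists>t. c d t \<noteq> 0) \<and>
     (\<forall>t>0. f t = (\<Sum>i\<le>d. c i t * of_int t ^ i))"

definition quasipolynomial_with_leading_coeff :: "nat \<Rightarrow> real \<Rightarrow> (int \<Rightarrow> real) \<Rightarrow> bool" where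
  "quasipolynomial_with_leading_coeff d a f \<longleftrightarrow>
     (\<exists>c. quasipolynomial_coeffs d c f \<and> (\<forall>t. c d t = a))"

end

theory Submission
  imports Defs
begin

text \<open>All three counts are sums of an indicator function over the integer points with
  \<open>0 < x\<^sub>1 < \<dots> < x\<^sub>m = t\<close>, and the indicator is a Boolean combination of homogeneous linear
  equations and inequalities. Consider the algebra of functions of integer variables that is
  generated by the one-variable quasipolynomials in linear forms and by the indicators of
  \<open>l > 0\<close> for linear forms \<open>l\<close>. It is closed under summing out one variable \<open>x\<close> over
  \<open>0 < x < u\<close>, \<open>u\<close> a linear form: comparing the bounds that are imposed on \<open>x\<close>, one reduces to
  sums of quasipolynomials over intervals. As everything stays homogeneous, for a single variable
  \<open>t > 0\<close> the indicators become constant, so that one gets a quasipolynomial for all \<open>t > 0\<close>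
  and not just for large \<open>t\<close>.

  For the leading coefficient, the number of all rulers is \<open>(t - 1) choose (m - 1)\<close>, and the
  excluded ones lie on finitely many hyperplanes, which contain \<open>O(t\<^bsup>m - 2\<^esup>)\<close> of them.\<close>

section \<open>Quasipolynomials in one variable\<close>

text \<open>A constituent polynomial is attached to every integer, with period \<open>N\<close>,
  instead of periodic coefficients. Sums, products and substitutions then act pointwise on
  \<open>P\<close>, and no degree has to be tracked.\<close>

definition quasipoly_rep :: "(int \<Rightarrow> real) \<Rightarrow> (int \<Rightarrow> real poly) \<Rightarrow> int \<Rightarrow> bool" where
  "quasipoly_rep f P N \<longleftrightarrow> N > 0 \<and> (\<forall>n. P (n + N) = P n) \<and> (\<forall>n. f n = poly (P n) (of_int n))"

definition quasipoly :: "(int \<Rightarrow> real) \<Rightarrow> bool" where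
  "quasipoly f \<longleftrightarrow> (\<exists>P N. quasipoly_rep f P N)"

lemma periodic_add_mult:
  fixes P :: "int \<Rightarrow> 'a"
  assumes "\<And>n. P (n + N) = P n"
  shows "P (n + k * N) = P n"
proof -
  interpret periodic_fun_simple P N by standard (rule assms)
  show ?thesis using plus_of_int[of n k] by simp
qed

lemma periodic_mod:
  fixes P :: "int \<Rightarrow> 'a"
  assumes "\<And>n. P (n + N) = P n"
  shows "P (n mod N) = P n"
  using periodic_add_mult[of P N "n mod N" "n div N", OF assms] by (simp add: add.commute)

lemma quasipolyI:
  assumes "N > 0" "\<And>n. P (n + N) = P n" "\<And>n. f n = poly (P n) (of_int n)"
  shows "quasipoly f"
  using assms unfolding quasipoly_def quasipoly_rep_def by blast

lemma quasipoly_repD: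
  assumes "quasipoly_rep f P N"
  shows "N > 0" "P (n + k * N) = P n" "f n = poly (P n) (of_int n)"
  using assms periodic_add_mult[of P N] by (auto simp: quasipoly_rep_def)

lemma quasipoly_periodic:
  assumes "N > 0" "\<And>n. f (n + N) = f n"
  shows "quasipoly f"
  by (rule quasipolyI[of N "\<lambda>n. [:f n:]"]) (use assms in auto)

lemma quasipoly_const [simp]: "quasipoly (\<lambda>_. c)"
  by (rule quasipoly_periodic[of 1]) auto

lemma quasipoly_of_int [simp]: "quasipoly of_int"
  by (rule quasipolyI[of 1 "\<lambda>_. [:0, 1:]"]) auto

lemma quasipoly_add:
  assumes "quasipoly f" "quasipoly g"
  shows "quasipoly (\<lambda>n. f n + g n)"
proof -
  obtain P N where "quasipoly_rep f P N"
    using assms(1) by (auto simp: quasipoly_def)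
  note P = quasipoly_repD[OF this]
  obtain R K where "quasipoly_rep g R K"
    using assms(2) by (auto simp: quasipoly_def)
  note R = quasipoly_repD[OF this]
  show ?thesis
    by (rule quasipolyI[of "N * K" "\<lambda>n. P n + R n"])
       (use P R P(2)[of _ K] in \<open>auto simp: mult.commute[of N K]\<close>, metis R(2) mult.commute)
qed

lemma quasipoly_mult:
  assumes "quasipoly f" "quasipoly g"
  shows "quasipoly (\<lambda>n. f n * g n)"
proof -
  obtain P N where "quasipoly_rep f P N"
    using assms(1) by (auto simp: quasipoly_def)
  note P = quasipoly_repD[OF this]
  obtain R K where "quasipoly_rep g R K"
    using assms(2) by (auto simp: quasipoly_def)
  note R = quasipoly_repD[OF this]
  show ?thesis
    by (rule quasipolyI[of "N * K" "\<lambda>n. P n * R n"])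
       (use P R P(2)[of _ K] in \<open>auto simp: mult.commute[of N K]\<close>, metis R(2) mult.commute)
qed

lemma quasipoly_sum: "(\<And>i. i \<in> A \<Longrightarrow> quasipoly (f i)) \<Longrightarrow> quasipoly (\<lambda>n. \<Sum>i\<in>A. f i n)"
  by (induction A rule: infinite_finite_induct) (auto intro: quasipoly_add)

text \<open>Replacing \<open>n\<close> by \<open>n + a * N\<close> raises the quotient by
  \<open>N\<close> and keeps the remainder, and for a fixed remainder the quotient is an affine
  function of \<open>n\<close> with rational coefficients. Such quotients arise as the largest
  \<open>x\<close> that satisfies an upper bound on \<open>a * x\<close>.\<close>

lemma quasipoly_div:
  assumes "quasipoly f" "a > 0"
  shows "quasipoly (\<lambda>n. f ((n + b) div a))"
proof -
  obtain P N where "quasipoly_rep f P N"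
    using assms(1) by (auto simp: quasipoly_def)
  note P = quasipoly_repD[OF this]
  have per: "(n + a * N + b) div a = (n + b) div a + 1 * N" "(n + a * N + b) mod a = (n + b) mod a" for n
  proof -
    have *: "n + a * N + b = (n + b) + N * a" by algebra
    show "(n + a * N + b) div a = (n + b) div a + 1 * N" "(n + a * N + b) mod a = (n + b) mod a"
      unfolding * using assms(2) by auto
  qed
  have eq: "real_of_int ((n + b) div a) = (of_int b - of_int ((n + b) mod a)) / of_int a + of_int n / of_int a" for n
  proof -
    have "real_of_int (n + b) = of_int (a * ((n + b) div a) + (n + b) mod a)" by simp
    then have "real_of_int n + of_int b = of_int a * of_int ((n + b) div a) + of_int ((n + b) mod a)"
      unfolding of_int_add of_int_mult .
    then show ?thesis using assms(2) by (simp add: field_simps)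
  qed
  show ?thesis
    by (rule quasipolyI[of "a * N" "\<lambda>n. pcompose (P ((n + b) div a))
           [:(of_int b - of_int ((n + b) mod a)) / of_int a, 1 / of_int a:]"])
       (use assms P in \<open>simp_all only: per P eq poly_pcompose, simp_all\<close>)
qed

lemma quasipoly_shift:
  assumes "quasipoly f"
  shows "quasipoly (\<lambda>n. f (n + b))"
  using quasipoly_div[OF assms, of 1 b] by simp

lemma quasipoly_scale:
  assumes "quasipoly f"
  shows "quasipoly (\<lambda>n. f (c * n))"
proof -
  obtain P N where "quasipoly_rep f P N"
    using assms(1) by (auto simp: quasipoly_def)
  note P = quasipoly_repD[OF this]
  show ?thesis
    by (rule quasipolyI[of N "\<lambda>n. pcompose (P (c * n)) [:0, of_int c:]"])
       (use P P(2)[of "c * _" c] in \<open>auto simp: poly_pcompose distrib_left\<close>, simp add: mult.commute)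
qed

section \<open>Antidifferences and summation\<close>

lemma power_antidifference:
  fixes c :: real
  assumes "c \<noteq> 0"
  shows "\<exists>F. \<forall>x. poly F x - poly F (x - c) = x ^ d"
proof (induction d rule: less_induct)
  case (less d)
  then obtain F where F: "\<And>k x. k < d \<Longrightarrow> poly (F k) x - poly (F k) (x - c) = x ^ k" by metis
  \<comment> \<open>\<open>w k\<close> is the coefficient of \<open>x ^ k\<close> in
    \<open>(x - c) ^ Suc d\<close>. The difference of \<open>x ^ Suc d\<close> has leading term
    \<open>Suc d * c * x ^ d\<close>; adding the antidifferences \<open>F k\<close> with weights
    \<open>w k\<close> cancels the lower terms.\<close>
  define w where "w k = of_nat (Suc d choose k) * (- c) ^ (Suc d - k)" for k
  define G where "G = smult (1 / (of_nat (Suc d) * c)) (monom 1 (Suc d) + (\<Sum>k<d. smult (w k) (F k)))"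
  have "poly G x - poly G (x - c) = x ^ d" for x
  proof -
    have "(x - c) ^ Suc d = (\<Sum>k\<le>Suc d. w k * x ^ k)"
      using binomial_ring[of x "- c" "Suc d"] by (simp add: w_def algebra_simps)
    also have "\<dots> = (\<Sum>k<d. w k * x ^ k) - of_nat (Suc d) * c * x ^ d + x ^ Suc d"
    proof -
      have "{..Suc d} = insert (Suc d) (insert d {..<d})" by auto
      then show ?thesis by (simp add: w_def algebra_simps)
    qed
    finally have 1: "x ^ Suc d - (x - c) ^ Suc d + (\<Sum>k<d. w k * x ^ k) = of_nat (Suc d) * c * x ^ d"
      by simp
    have "poly G x - poly G (x - c) = 1 / (of_nat (Suc d) * c) *
        (x ^ Suc d - (x - c) ^ Suc d + (\<Sum>k<d. w k * (poly (F k) x - poly (F k) (x - c))))"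
      unfolding G_def
      by (simp only: poly_smult poly_add poly_monom poly_sum right_diff_distrib sum_subtractf)
         (simp add: algebra_simps)
    also have "\<dots> = 1 / (of_nat (Suc d) * c) * (of_nat (Suc d) * c * x ^ d)"
      unfolding 1[symmetric] using F by simp
    also have "\<dots> = x ^ d" using assms by (simp del: of_nat_Suc)
    finally show ?thesis .
  qed
  then show ?case by blast
qed

lemma poly_antidifference:
  fixes c :: real
  assumes "c \<noteq> 0"
  shows "\<exists>F. \<forall>x. poly F x - poly F (x - c) = poly p x"
proof -
  obtain F where F: "\<And>k x. poly (F k) x - poly (F k) (x - c) = x ^ k"
    using power_antidifference[OF assms] by metis
  have "poly (\<Sum>i\<le>degree p. smult (coeff p i) (F i)) x -
      poly (\<Sum>i\<le>degree p. smult (coeff p i) (F i)) (x - c) = poly p x" for x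
    by (simp add: poly_sum poly_altdef[of p] F flip: sum_subtractf right_diff_distrib)
  then show ?thesis by blast
qed

text \<open>An antidifference with step \<open>N\<close>, the period, can be taken coefficientwise; its sum over
  \<open>N\<close> consecutive integers then telescopes to an antidifference with step \<open>1\<close>.\<close>
lemma quasipoly_antidifference:
  assumes "quasipoly f"
  shows "\<exists>H. quasipoly H \<and> (\<forall>n. H n - H (n - 1) = f n)"
proof -
  obtain P N where "quasipoly_rep f P N"
    using assms(1) by (auto simp: quasipoly_def)
  note P = quasipoly_repD[OF this]
  have "\<forall>p. \<exists>F. \<forall>x. poly F x - poly F (x - real_of_int N) = poly p x"
    using P(1) poly_antidifference[of "real_of_int N"] by simp
  from choice[OF this] obtain F
    where "\<forall>p x. poly (F p) x - poly (F p) (x - real_of_int N) = poly p x" ..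
  note F = this[rule_format]
  define G where "G n = poly (F (P n)) (of_int n)" for n
  define H where "H n = (\<Sum>j<nat N. G (n - int j))" for n
  have "quasipoly G"
    by (rule quasipolyI[of N "\<lambda>n. F (P n)"]) (use P P(2)[of _ 1] in \<open>auto simp: G_def\<close>)
  then have "quasipoly H"
    using quasipoly_sum[of "{..<nat N}" "\<lambda>j n. G (n - int j)"] quasipoly_shift[of G "- int _"]
    unfolding H_def by simp
  moreover have "H n - H (n - 1) = f n" for n
  proof -
    have "H n - H (n - 1) = (\<Sum>j<nat N. G (n - int j) - G (n - int (Suc j)))"
      by (simp add: H_def sum_subtractf algebra_simps)
    also have "\<dots> = G n - G (n - N)"
      by (subst sum_lessThan_telescope') (use P(1) in auto)
    also have "P (n - N) = P n" using P(2)[of n "-1"] by simp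
    then have "G n - G (n - N) = f n" using F[of "P n" "of_int n"] by (simp add: G_def P(3))
    finally show ?thesis .
  qed
  ultimately show ?thesis by (intro exI[of _ H]) simp
qed

text \<open>The antidifference telescopes, and its value at 0 is subtracted. The range
  \<open>n \<ge> 0\<close> matters: for negative \<open>n\<close> the sum is empty, while the
  quasipolynomial in general does not vanish there.\<close>

lemma quasipoly_summation:
  assumes "quasipoly f"
  shows "\<exists>H. quasipoly H \<and> (\<forall>n\<ge>0. (\<Sum>x\<in>{1..n}. f x) = H n)"
proof -
  obtain G where G: "quasipoly G \<and> (\<forall>n. G n - G (n - 1) = f n)"
    using quasipoly_antidifference[OF assms] ..
  have "(\<Sum>x\<in>{1..n}. f x) = G n + (- G 0)" if "n \<ge> 0" for n
    using that
  proof (induction n rule: int_ge_induct)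
    case (step n)
    have "{1..n + 1} = insert (n + 1) {1..n}" using step by auto
    then show ?case using step conjunct2[OF G, rule_format, of "n + 1"] by simp
  qed auto
  then show ?thesis using quasipoly_add[OF conjunct1[OF G] quasipoly_const[of "- G 0"]] by (intro exI[of _ "\<lambda>n. G n + (- G 0)"]) simp
qed

section \<open>Summing out a variable\<close>

definition linear_form :: "nat \<Rightarrow> ((nat \<Rightarrow> int) \<Rightarrow> int) \<Rightarrow> bool" where
  "linear_form k l \<longleftrightarrow> (\<exists>c. l = (\<lambda>y. \<Sum>i<k. c i * y i))"

lemma linear_form_sum [simp]: "linear_form k (\<lambda>y. \<Sum>i<k. c i * y i)"
  by (auto simp: linear_form_def)

lemma linear_form_zero [simp]: "linear_form k (\<lambda>_. 0)"
  using linear_form_sum[of k "\<lambda>_. 0"] by simp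

lemma linear_form_coordinate: "i < k \<Longrightarrow> linear_form k (\<lambda>y. y i)"
  using linear_form_sum[of k "\<lambda>j. of_bool (j = i)"] by simp

lemma linear_form_add: "linear_form k l \<Longrightarrow> linear_form k l' \<Longrightarrow> linear_form k (\<lambda>y. l y + l' y)"
proof -
  assume "linear_form k l" "linear_form k l'"
  then obtain c c' where "l = (\<lambda>y. \<Sum>i<k. c i * y i)" "l' = (\<lambda>y. \<Sum>i<k. c' i * y i)"
    by (auto simp: linear_form_def)
  then have "(\<lambda>y. l y + l' y) = (\<lambda>y. \<Sum>i<k. (c i + c' i) * y i)"
    by (simp add: distrib_right sum.distrib)
  then show ?thesis by simp
qed

lemma linear_form_scale: "linear_form k l \<Longrightarrow> linear_form k (\<lambda>y. a * l y)"
proof -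
  assume "linear_form k l"
  then obtain c where "l = (\<lambda>y. \<Sum>i<k. c i * y i)"
    by (auto simp: linear_form_def)
  then have "(\<lambda>y. a * l y) = (\<lambda>y. \<Sum>i<k. (a * c i) * y i)"
    by (simp add: sum_distrib_left mult.assoc)
  then show ?thesis by simp
qed

lemma linear_form_uminus: "linear_form k l \<Longrightarrow> linear_form k (\<lambda>y. - l y)"
  using linear_form_scale[of k l "-1"] by simp

lemma linear_form_diff: "linear_form k l \<Longrightarrow> linear_form k l' \<Longrightarrow> linear_form k (\<lambda>y. l y - l' y)"
  using linear_form_add[OF _ linear_form_uminus] by fastforce

lemma linear_form_update:
  assumes "linear_form (Suc k) l"
  shows "\<exists>l' c. linear_form k l' \<and> (\<forall>y x. l (y(k := x)) = l' y + c * x)"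
proof -
  obtain c where "l = (\<lambda>y. \<Sum>i<Suc k. c i * y i)"
    using assms by (auto simp: linear_form_def)
  then show ?thesis
    by (intro exI[of _ "\<lambda>y. \<Sum>i<k. c i * y i"] exI[of _ "c k"]) simp
qed

text \<open>Complements and products of the \<open>pos\<close> generators give all Boolean
  combinations of homogeneous linear equations and inequalities. Congruence conditions are covered
  by \<open>quasipoly\<close>, since periodic functions are quasipolynomials.\<close>

inductive_set pw_quasipoly :: "nat \<Rightarrow> ((nat \<Rightarrow> int) \<Rightarrow> real) set" for k where
  quasipoly: "quasipoly q \<Longrightarrow> linear_form k l \<Longrightarrow> (\<lambda>y. q (l y)) \<in> pw_quasipoly k"
| pos: "linear_form k l \<Longrightarrow> (\<lambda>y. of_bool (0 < l y)) \<in> pw_quasipoly k"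
| add: "f \<in> pw_quasipoly k \<Longrightarrow> f' \<in> pw_quasipoly k \<Longrightarrow> (\<lambda>y. f y + f' y) \<in> pw_quasipoly k"
| mult: "f \<in> pw_quasipoly k \<Longrightarrow> f' \<in> pw_quasipoly k \<Longrightarrow> (\<lambda>y. f y * f' y) \<in> pw_quasipoly k"

lemma pw_quasipoly_const [simp]: "(\<lambda>_. c) \<in> pw_quasipoly k"
  using pw_quasipoly.quasipoly[OF quasipoly_const linear_form_zero] .

lemma pw_quasipoly_diff: "f \<in> pw_quasipoly k \<Longrightarrow> f' \<in> pw_quasipoly k \<Longrightarrow> (\<lambda>y. f y - f' y) \<in> pw_quasipoly k"
  using pw_quasipoly.add[OF _ pw_quasipoly.mult[OF pw_quasipoly_const[of "-1"]], of f k f'] by simp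

lemma pw_quasipoly_less:
  assumes "linear_form k l" "linear_form k l'"
  shows "(\<lambda>y. of_bool (l y < l' y)) \<in> pw_quasipoly k"
  using pw_quasipoly.pos[OF linear_form_diff[OF assms(2,1)]] by simp

lemma pw_quasipoly_not: "(\<lambda>y. of_bool (P y)) \<in> pw_quasipoly k \<Longrightarrow> (\<lambda>y. of_bool (\<not> P y)) \<in> pw_quasipoly k"
  using pw_quasipoly_diff[OF pw_quasipoly_const[of 1], of "\<lambda>y. of_bool (P y)" k] by (simp add: of_bool_not_iff)

lemma pw_quasipoly_conj:
  assumes "(\<lambda>y. of_bool (P y)) \<in> pw_quasipoly k" "(\<lambda>y. of_bool (Q y)) \<in> pw_quasipoly k"
  shows "(\<lambda>y. of_bool (P y \<and> Q y)) \<in> pw_quasipoly k"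
  using pw_quasipoly.mult[OF assms] by (simp add: of_bool_conj)

lemma pw_quasipoly_ball:
  assumes "finite A" "\<And>i. i \<in> A \<Longrightarrow> (\<lambda>y. of_bool (P i y)) \<in> pw_quasipoly k"
  shows "(\<lambda>y. of_bool (\<forall>i\<in>A. P i y)) \<in> pw_quasipoly k"
  using assms
proof (induction A)
  case (insert i A)
  then show ?case using pw_quasipoly_conj[of "P i" k "\<lambda>y. \<forall>i\<in>A. P i y"] by simp
qed simp

lemma pw_quasipoly_eq:
  assumes "linear_form k l" "linear_form k l'"
  shows "(\<lambda>y. of_bool (l y = l' y)) \<in> pw_quasipoly k"
proof -
  have "(\<lambda>y. of_bool (\<not> l y < l' y \<and> \<not> l' y < l y)) \<in> pw_quasipoly k"
    by (intro pw_quasipoly_conj pw_quasipoly_not pw_quasipoly_less assms)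
  moreover have "(\<not> l y < l' y \<and> \<not> l' y < l y) \<longleftrightarrow> l y = l' y" for y by auto
  ultimately show ?thesis by (simp only:)
qed

text \<open>A linear combination of functions that are cut off at one upper threshold \<open>l y / a\<close> for \<open>x\<close>;
  the threshold is excluded if \<open>e = 0\<close> and included if \<open>e = 1\<close>. Only the values for \<open>0 < x < u y\<close>
  matter. Lower bounds are differences of upper bounds, and a product of two cutoffs is a cutoff at
  the smaller threshold; which one is smaller is decided by an indicator in \<open>y\<close>.\<close>
inductive_set threshold_form ::
  "nat \<Rightarrow> ((nat \<Rightarrow> int) \<Rightarrow> int) \<Rightarrow> ((nat \<Rightarrow> int) \<Rightarrow> int \<Rightarrow> real) set" for k u where
  cell: "g \<in> pw_quasipoly k \<Longrightarrow> quasipoly q \<Longrightarrow> a > 0 \<Longrightarrow> linear_form k l \<Longrightarrow> e \<in> {0, 1} \<Longrightarrow>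
    (\<lambda>y x. g y * q x * of_bool (a * x < l y + e)) \<in> threshold_form k u"
| add: "f \<in> threshold_form k u \<Longrightarrow> f' \<in> threshold_form k u \<Longrightarrow> (\<lambda>y x. f y x + f' y x) \<in> threshold_form k u"
| cong: "f \<in> threshold_form k u \<Longrightarrow> (\<And>y x. 0 < x \<Longrightarrow> x < u y \<Longrightarrow> f' y x = f y x) \<Longrightarrow> f' \<in> threshold_form k u"

text \<open>The threshold \<open>u\<close> itself, excluded, cuts off nothing in the range
  \<open>0 < x < u y\<close>, so a product without a cutoff is a cell as well.\<close>

lemma threshold_form_separated:
  assumes "g \<in> pw_quasipoly k" "quasipoly q" "linear_form k u"
  shows "(\<lambda>y x. g y * q x) \<in> threshold_form k u"
  by (rule threshold_form.cong[OF threshold_form.cell[OF assms(1,2) zero_less_one assms(3), of 0]]) auto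

lemma threshold_form_const: "linear_form k u \<Longrightarrow> (\<lambda>_ _. c) \<in> threshold_form k u"
  using threshold_form_separated[OF pw_quasipoly_const quasipoly_const[of 1]] by fastforce

text \<open>The thresholds \<open>l / a\<close> and \<open>l' / a'\<close> are compared after
  cross-multiplication. If they differ, the smaller one decides whatever \<open>e\<close> and
  \<open>e'\<close> are, as these only turn \<open><\<close> into \<open>\<le>\<close>; at a tie the
  strict cutoff wins, hence \<open>min e e'\<close>. The comparisons therefore stay homogeneous in
  \<open>l\<close> and \<open>l'\<close>.\<close>

lemma threshold_mult:
  fixes x a l e a' l' e' :: int
  assumes "a > 0" "a' > 0" "e \<in> {0, 1}" "e' \<in> {0, 1}"
  shows "of_bool (a * x < l + e) * of_bool (a' * x < l' + e') =
    of_bool (a' * l < a * l') * of_bool (a * x < l + e) +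
    of_bool (a * l' < a' * l) * of_bool (a' * x < l' + e') +
    (of_bool (a' * l = a * l') * of_bool (a * x < l + min e e') :: real)"
proof -
  have le: "a * x \<le> l \<longleftrightarrow> a * (a' * x) \<le> a' * l" "a' * x \<le> l' \<longleftrightarrow> a * (a' * x) \<le> a * l'"
    using assms(1,2) by (auto simp: mult.left_commute[of a])
  have less: "a * x < l \<longleftrightarrow> a * (a' * x) < a' * l" "a' * x < l' \<longleftrightarrow> a * (a' * x) < a * l'"
    using assms(1,2) by (auto simp: mult.left_commute[of a])
  have plus: "a * x < l + 1 \<longleftrightarrow> a * x \<le> l" "a' * x < l' + 1 \<longleftrightarrow> a' * x \<le> l'" by auto
  show ?thesis
    using assms(3,4) by (auto simp: plus le less)
qed

lemma threshold_form_mult: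
  assumes "f \<in> threshold_form k u" "f' \<in> threshold_form k u"
  shows "(\<lambda>y x. f y x * f' y x) \<in> threshold_form k u"
  using assms(1)
proof induction
  case (cell g q a l e)
  note c = this
  show ?case using assms(2)
  proof induction
    case (cell g' q' a' l' e')
    have lf: "linear_form k (\<lambda>y. a' * l y)" "linear_form k (\<lambda>y. a * l' y)"
      using c(4) cell(4) by (auto intro: linear_form_scale)
    have gg: "(\<lambda>y. g y * g' y) \<in> pw_quasipoly k" and qq: "quasipoly (\<lambda>x. q x * q' x)"
      using c cell by (auto intro: pw_quasipoly.mult quasipoly_mult)
    have e: "min e e' \<in> {0, 1}" using c cell by auto
    have "(\<lambda>y x. (g y * g' y * of_bool (a' * l y < a * l' y)) * (q x * q' x) * of_bool (a * x < l y + e)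
        + (g y * g' y * of_bool (a * l' y < a' * l y)) * (q x * q' x) * of_bool (a' * x < l' y + e')
        + (g y * g' y * of_bool (a' * l y = a * l' y)) * (q x * q' x) * of_bool (a * x < l y + min e e'))
      \<in> threshold_form k u"
      by (intro threshold_form.add threshold_form.cell[OF pw_quasipoly.mult[OF gg pw_quasipoly_less[OF lf]] qq c(3,4,5)]
            threshold_form.cell[OF pw_quasipoly.mult[OF gg pw_quasipoly_less[OF lf(2,1)]] qq cell(3,4,5)]
            threshold_form.cell[OF pw_quasipoly.mult[OF gg pw_quasipoly_eq[OF lf]] qq c(3,4) e])
    moreover have "g y * q x * of_bool (a * x < l y + e) * (g' y * q' x * of_bool (a' * x < l' y + e')) =
        (g y * g' y * of_bool (a' * l y < a * l' y)) * (q x * q' x) * of_bool (a * x < l y + e)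
        + (g y * g' y * of_bool (a * l' y < a' * l y)) * (q x * q' x) * of_bool (a' * x < l' y + e')
        + (g y * g' y * of_bool (a' * l y = a * l' y)) * (q x * q' x) * of_bool (a * x < l y + min e e')"
      for y x
    proof -
      have "g y * q x * of_bool (a * x < l y + e) * (g' y * q' x * of_bool (a' * x < l' y + e')) =
         (g y * g' y) * (q x * q' x) * (of_bool (a * x < l y + e) * of_bool (a' * x < l' y + e'))"
        by (simp only: mult_ac)
      then show ?thesis
        unfolding threshold_mult[OF c(3) cell(3) c(5) cell(5)] by (simp only: distrib_left mult_ac)
    qed
    ultimately show ?case by (rule threshold_form.cong)
  next
    case (add f f')
    then show ?case using threshold_form.add[OF add.IH] by (simp only: distrib_left)
  next
    case (cong f f')
    show ?case by (rule threshold_form.cong[OF cong.IH]) (use cong in simp)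
  qed
next
  case (add f f')
  then show ?case using threshold_form.add[OF add.IH] by (simp only: distrib_right)
next
  case (cong f f'')
  show ?case by (rule threshold_form.cong[OF cong.IH]) (use cong in simp)
qed

lemma threshold_form_power: "f \<in> threshold_form k u \<Longrightarrow> linear_form k u \<Longrightarrow> (\<lambda>y x. f y x ^ n) \<in> threshold_form k u"
  by (induction n) (auto intro: threshold_form_mult threshold_form_const)

lemma threshold_form_sum:
  "linear_form k u \<Longrightarrow> (\<And>i. i \<in> A \<Longrightarrow> f i \<in> threshold_form k u) \<Longrightarrow> (\<lambda>y x. \<Sum>i\<in>A. f i y x) \<in> threshold_form k u"
  by (induction A rule: infinite_finite_induct) (auto intro: threshold_form.add threshold_form_const)

text \<open>The variables are separated by residues modulo the period: \<open>s\<close> is the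
  residue of \<open>c * x\<close>, which depends on \<open>x\<close> alone, and then the total
  residue \<open>r\<close> is a condition on \<open>l y\<close> alone. For fixed residues
  \<open>q\<close> is a polynomial in \<open>l y + c * x\<close>, which is built from separated
  products by sums and powers.\<close>

lemma threshold_form_quasipoly_affine:
  assumes "quasipoly q" "linear_form k l" "linear_form k u"
  shows "(\<lambda>y x. q (l y + c * x)) \<in> threshold_form k u"
proof -
  obtain P N where "quasipoly_rep q P N"
    using assms(1) by (auto simp: quasipoly_def)
  note P = quasipoly_repD[OF this]
  have Pmod: "P (n mod N) = P n" for n using P(2)[of _ 1] by (intro periodic_mod) simp
  \<comment> \<open>The factor \<open>1\<close> after \<open>of_int (l y)\<close> gives that term
    the shape \<open>g y * q x\<close> of a separated product.\<close>
  have eq: "q (l y + c * x) = (\<Sum>r\<in>{0..<N}. \<Sum>s\<in>{0..<N}. \<Sum>i\<le>degree (P r). coeff (P r) i *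
      (of_bool ((l y + s) mod N = r) * of_bool (c * x mod N = s)) *
      (of_int (l y) * 1 + of_int c * of_int x) ^ i)" for y x
  proof -
    have "(\<Sum>r\<in>{0..<N}. \<Sum>s\<in>{0..<N}. \<Sum>i\<le>degree (P r). coeff (P r) i *
      (of_bool ((l y + s) mod N = r) * of_bool (c * x mod N = s)) *
      (of_int (l y) * 1 + of_int c * of_int x) ^ i) =
      (\<Sum>r\<in>{0..<N}. \<Sum>s\<in>{0..<N}. of_bool (s = c * x mod N) * (of_bool (r = (l y + s) mod N) *
        poly (P r) (of_int (l y + c * x))))"
      by (simp add: poly_altdef sum_distrib_left mult_ac eq_commute)
    also have "\<dots> = (\<Sum>r\<in>{0..<N}. of_bool (r = (l y + c * x mod N) mod N) *
        poly (P r) (of_int (l y + c * x)))"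
      using P(1) by (simp add: of_bool_def if_distrib[of "\<lambda>t. t * _"] cong: if_cong)
    also have "\<dots> = poly (P ((l y + c * x mod N) mod N)) (of_int (l y + c * x))"
      using P(1) by (simp add: of_bool_def if_distrib[of "\<lambda>t. t * _"] cong: if_cong)
    also have "\<dots> = q (l y + c * x)"
      by (simp add: mod_add_right_eq Pmod P(3))
    finally show ?thesis ..
  qed
  have per1: "quasipoly (\<lambda>n. of_bool ((n + s) mod N = r))" for s r
    by (rule quasipoly_periodic[OF P(1)]) (use mod_add_self2[of "_ + s" N] in \<open>simp add: ac_simps\<close>)
  have per2: "quasipoly (\<lambda>x. of_bool (c * x mod N = s))" for s
    by (rule quasipoly_periodic[OF P(1)]) (simp add: distrib_left)
  show ?thesis
    unfolding eq
    by (intro threshold_form_sum threshold_form_mult threshold_form_power threshold_form.add threshold_form_const assms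
          threshold_form_separated[OF pw_quasipoly.quasipoly[OF per1 assms(2)] per2]
          threshold_form_separated[OF pw_quasipoly.quasipoly[OF quasipoly_of_int assms(2)] quasipoly_const]
          threshold_form_separated[OF pw_quasipoly_const quasipoly_of_int])
qed

lemma threshold_form_update:
  assumes "f \<in> pw_quasipoly (Suc k)" "linear_form k u"
  shows "(\<lambda>y x. f (y(k := x))) \<in> threshold_form k u"
  using assms(1)
proof induction
  case (quasipoly q l)
  obtain l' c where l': "linear_form k l'" and eq: "\<And>y x. l (y(k := x)) = l' y + c * x"
    using linear_form_update[OF quasipoly(2)] by auto
  show ?case unfolding eq by (rule threshold_form_quasipoly_affine[OF quasipoly(1) l' assms(2)])
next
  case (pos l)
  obtain l' c where l': "linear_form k l'" and eq: "\<And>y x. l (y(k := x)) = l' y + c * x"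
    using linear_form_update[OF pos] by auto
  \<comment> \<open>For \<open>c < 0\<close>, positivity of \<open>l' y + c * x\<close> is a strict
    upper bound on \<open>x\<close>. For \<open>c > 0\<close> it is the complement of the weak upper
    bound \<open>c * x \<le> - l' y\<close>; this is where \<open>e = 1\<close> enters, so that the
    form itself needs no constant term.\<close>
  consider "c = 0" | "c < 0" | "c > 0" by linarith
  then show ?case
  proof cases
    case 1
    then show ?thesis
      using threshold_form_separated[OF pw_quasipoly.pos[OF l'] quasipoly_const[of 1] assms(2)] unfolding eq by simp
  next
    case 2
    have "(\<lambda>y x. 1 * 1 * of_bool (- c * x < l' y + 0)) \<in> threshold_form k u"
      by (intro threshold_form.cell quasipoly_const pw_quasipoly_const l') (use 2 in auto)
    then show ?thesis by (rule threshold_form.cong) (unfold eq, auto)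
  next
    case 3
    have "(\<lambda>y x. 1 + (-1) * 1 * of_bool (c * x < - l' y + 1)) \<in> threshold_form k u"
      by (intro threshold_form.add threshold_form_const threshold_form.cell quasipoly_const pw_quasipoly_const linear_form_uminus l' 3 assms(2)) simp
    then show ?thesis by (rule threshold_form.cong) (unfold eq, auto)
  qed
next
  case (add f f')
  then show ?case by (intro threshold_form.add)
next
  case (mult f f')
  then show ?case by (intro threshold_form_mult)
qed

section \<open>Summing threshold forms over an interval\<close>

lemma int_le_div_iff:
  fixes a x n :: int
  assumes "a > 0"
  shows "x \<le> n div a \<longleftrightarrow> a * x \<le> n"
proof
  assume "x \<le> n div a"
  then have "a * x \<le> a * (n div a)" using assms by simp
  also have "\<dots> \<le> n" using pos_mod_sign[OF assms, of n] mult_div_mod_eq[of a n] by linarith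
  finally show "a * x \<le> n" .
next
  assume "a * x \<le> n"
  then have "(a * x) div a \<le> n div a" using assms by (intro zdiv_mono1)
  then show "x \<le> n div a" using assms by simp
qed

text \<open>The upper end is the largest \<open>x\<close> with \<open>a * x < l y + e\<close>. For
  \<open>l y > 0\<close> it is nonnegative, so the summation formula applies; for
  \<open>l y \<le> 0\<close> it is at most 0, so the sum is empty. Thus the homogeneous indicator of
  \<open>0 < l y\<close> suffices for both values of \<open>e\<close>, and the constant
  \<open>e - 1\<close> goes into the quotient.\<close>

lemma pw_quasipoly_initial_sum:
  assumes "quasipoly q" "linear_form k l" "a > 0" "e \<in> {0, 1}"
  shows "(\<lambda>y. \<Sum>x\<in>{1..(l y + e - 1) div a}. q x) \<in> pw_quasipoly k"
proof -
  obtain H where "quasipoly H \<and> (\<forall>n\<ge>0. (\<Sum>x\<in>{1..n}. q x) = H n)"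
    using quasipoly_summation[OF assms(1)] ..
  then have H: "quasipoly H" "\<And>n. n \<ge> 0 \<Longrightarrow> (\<Sum>x\<in>{1..n}. q x) = H n" by auto
  have "(\<Sum>x\<in>{1..(l y + e - 1) div a}. q x) = of_bool (0 < l y) * H ((l y + (e - 1)) div a)" for y
  proof (cases "0 < l y")
    case True
    then have "(l y + e - 1) div a \<ge> 0" using assms(3,4) by (auto simp: pos_imp_zdiv_nonneg_iff)
    then show ?thesis using True by (simp add: H(2) add_diff_eq)
  next
    case False
    then have "(l y + e - 1) div a \<le> 0" using assms(3,4) by (auto intro: div_nonpos_pos_le0)
    then show ?thesis using False by simp
  qed
  then show ?thesis
    using pw_quasipoly.mult[OF pw_quasipoly.pos[OF assms(2)] pw_quasipoly.quasipoly[OF quasipoly_div[OF H(1) assms(3), of "e - 1"] assms(2)]]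
    by simp
qed

lemma sum_threshold_form_pw_quasipoly:
  assumes "f \<in> threshold_form k u" "linear_form k u"
  shows "(\<lambda>y. \<Sum>x\<in>{0<..<u y}. f y x) \<in> pw_quasipoly k"
  using assms(1)
proof induction
  case (cell g q a l e)
  \<comment> \<open>The smaller of the bounds \<open>u y\<close> and \<open>l y / a\<close> is
    effective. The bound \<open>x < u y\<close> is written with \<open>+ 0\<close>,
    \<open>- 1\<close> and \<open>div 1\<close> so that both sums are instances of the same initial
    sum.\<close>
  have "(\<Sum>x\<in>{0<..<u y}. g y * q x * of_bool (a * x < l y + e)) =
      g y * (of_bool (\<not> l y < a * u y) * (\<Sum>x\<in>{1..(u y + 0 - 1) div 1}. q x) +
             of_bool (l y < a * u y) * (\<Sum>x\<in>{1..(l y + e - 1) div a}. q x))" for y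
  proof -
    have "(\<Sum>x\<in>{0<..<u y}. g y * q x * of_bool (a * x < l y + e)) =
        g y * (\<Sum>x\<in>{x\<in>{0<..<u y}. a * x < l y + e}. q x)"
      unfolding sum.inter_filter[OF finite_greaterThanLessThan_int] sum_distrib_left
      by (intro sum.cong) auto
    moreover have "{x\<in>{0<..<u y}. a * x < l y + e} = {1..(l y + e - 1) div a}" if "l y < a * u y"
    proof -
      have "x < u y" if "a * x < l y + e" for x
      proof -
        have "a * x < a * u y" using that \<open>l y < a * u y\<close> cell(5) by auto
        then show ?thesis using cell(3) by simp
      qed
      moreover have "x \<le> (l y + e - 1) div a \<longleftrightarrow> a * x < l y + e" for x
        using int_le_div_iff[OF cell(3), of x "l y + e - 1"] by auto
      ultimately show ?thesis by auto
    qed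
    moreover have "{x\<in>{0<..<u y}. a * x < l y + e} = {1..(u y + 0 - 1) div 1}" if "\<not> l y < a * u y"
    proof -
      have "a * x < l y + e" if "x < u y" for x
      proof -
        have "a * x < a * u y" using that cell(3) by simp
        then show ?thesis using \<open>\<not> l y < a * u y\<close> cell(5) by auto
      qed
      then show ?thesis by auto
    qed
    ultimately show ?thesis by (cases "l y < a * u y") simp_all
  qed
  moreover have "(\<lambda>y. g y * (of_bool (\<not> l y < a * u y) * (\<Sum>x\<in>{1..(u y + 0 - 1) div 1}. q x) +
      of_bool (l y < a * u y) * (\<Sum>x\<in>{1..(l y + e - 1) div a}. q x))) \<in> pw_quasipoly k"
    by (intro pw_quasipoly.mult pw_quasipoly.add pw_quasipoly_not pw_quasipoly_less pw_quasipoly_initial_sum linear_form_scale cell assms(2)) auto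
  ultimately show ?case by simp
next
  case (add f f')
  then show ?case by (simp add: sum.distrib pw_quasipoly.add)
next
  case (cong f f')
  then have "(\<lambda>y. \<Sum>x\<in>{0<..<u y}. f' y x) = (\<lambda>y. \<Sum>x\<in>{0<..<u y}. f y x)"
    by (auto simp: fun_eq_iff intro!: sum.cong)
  then show ?case using cong.IH by simp
qed

theorem pw_quasipoly_sum_update:
  assumes "f \<in> pw_quasipoly (Suc k)" "linear_form k u"
  shows "(\<lambda>y. \<Sum>x\<in>{0<..<u y}. f (y(k := x))) \<in> pw_quasipoly k"
  by (rule sum_threshold_form_pw_quasipoly[OF threshold_form_update[OF assms] assms(2)])

lemma pw_quasipoly_one_quasipoly:
  assumes "f \<in> pw_quasipoly 1"
  shows "\<exists>q. quasipoly q \<and> (\<forall>t>0. f (\<lambda>_. t) = q t)"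
  using assms
proof induction
  case (quasipoly q l)
  then obtain c where "l = (\<lambda>y. c * y 0)" by (auto simp: linear_form_def)
  then show ?case using quasipoly_scale[OF quasipoly(1), of c] by (intro exI[of _ "\<lambda>n. q (c * n)"]) simp
next
  case (pos l)
  then obtain c where "l = (\<lambda>y. c * y 0)" by (auto simp: linear_form_def)
  then show ?case by (intro exI[of _ "\<lambda>n. of_bool (0 < c)"]) (simp add: zero_less_mult_iff)
next
  case (add f f')
  then obtain q q' where "quasipoly q" "\<forall>t>0. f (\<lambda>_. t) = q t" "quasipoly q'" "\<forall>t>0. f' (\<lambda>_. t) = q' t"
    by blast
  then show ?case by (intro exI[of _ "\<lambda>n. q n + q' n"]) (simp add: quasipoly_add)
next
  case (mult f f')
  then obtain q q' where "quasipoly q" "\<forall>t>0. f (\<lambda>_. t) = q t" "quasipoly q'" "\<forall>t>0. f' (\<lambda>_. t) = q' t"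
    by blast
  then show ?case by (intro exI[of _ "\<lambda>n. q n * q' n"]) (simp add: quasipoly_mult)
qed

section \<open>Leading coefficients\<close>

text \<open>Dividing by \<open>x n ^ degree p\<close> also gives a limit, the leading coefficient.
  If the degree were not \<open>d\<close>, one of the two quotients would be the other times a
  positive power of \<open>1 / x n\<close>, hence tend to 0, contradicting
  \<open>a \<noteq> 0\<close> or the nonvanishing of the leading coefficient. A general sequence
  \<open>x\<close> allows limits along one residue class.\<close>

lemma poly_growth:
  fixes p :: "real poly"
  assumes lim: "(\<lambda>n. poly p (x n) / x n ^ d) \<longlonglongrightarrow> a" and "a \<noteq> 0"
    and x: "filterlim x at_top sequentially"
  shows "degree p = d \<and> lead_coeff p = a"
proof -
  have inf: "filterlim x at_infinity sequentially"
    using x by (rule filterlim_at_top_imp_at_infinity)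
  have lead: "(\<lambda>n. poly p (x n) / x n ^ degree p) \<longlonglongrightarrow> lead_coeff p"
    by (rule filterlim_compose[OF poly_divide_tendsto_aux inf])
  have inv: "(\<lambda>n. inverse (x n) ^ Suc j) \<longlonglongrightarrow> 0" for j
    using tendsto_power[OF filterlim_compose[OF tendsto_inverse_0 inf], of "Suc j"] by simp
  have pos: "eventually (\<lambda>n. x n > 0) sequentially"
    using x by (simp add: filterlim_at_top_dense)
  consider "degree p < d" | "degree p > d" | "degree p = d" by linarith
  then show ?thesis
  proof cases
    case 1
    then obtain j where j: "d = degree p + Suc j" using less_imp_add_positive[OF 1] by (metis Suc_pred)
    have "(\<lambda>n. poly p (x n) / x n ^ degree p * inverse (x n) ^ Suc j) \<longlonglongrightarrow> 0"
      using tendsto_mult[OF lead inv[of j]] by simp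
    then have "(\<lambda>n. poly p (x n) / x n ^ d) \<longlonglongrightarrow> 0"
      by (rule Lim_transform_eventually)
         (use pos in eventually_elim, simp add: j power_add field_simps)
    then show ?thesis using LIMSEQ_unique[OF lim] \<open>a \<noteq> 0\<close> by simp
  next
    case 2
    then obtain j where j: "degree p = d + Suc j" using less_imp_add_positive[OF 2] by (metis Suc_pred)
    have "(\<lambda>n. poly p (x n) / x n ^ d * inverse (x n) ^ Suc j) \<longlonglongrightarrow> 0"
      using tendsto_mult[OF lim inv[of j]] by simp
    then have "(\<lambda>n. poly p (x n) / x n ^ degree p) \<longlonglongrightarrow> 0"
      by (rule Lim_transform_eventually)
         (use pos in eventually_elim, simp add: j power_add field_simps)
    then have "lead_coeff p = 0" using LIMSEQ_unique[OF lead] by simp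
    then show ?thesis using 2 by simp
  next
    case 3
    then show ?thesis using LIMSEQ_unique[OF lead] lim by simp
  qed
qed

text \<open>The growth along each residue class determines the degree and leading coefficient of the
  constituent polynomial of that class. As the limit is the same for all classes, the top
  coefficient is constant.\<close>

lemma quasipoly_leading_coeff:
  assumes "quasipoly q" and f: "\<And>t. t > 0 \<Longrightarrow> f t = q t"
    and lim: "(\<lambda>n. f (int n) / real n ^ d) \<longlonglongrightarrow> a" and "a \<noteq> 0"
  shows "quasipolynomial_with_leading_coeff d a f"
proof -
  obtain P N where "quasipoly_rep q P N"
    using assms(1) by (auto simp: quasipoly_def)
  note P = quasipoly_repD[OF this]
  have deg: "degree (P r) = d \<and> lead_coeff (P r) = a" for r
  proof -
    \<comment> \<open>The sequence runs through integers congruent to \<open>r\<close>; the summand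
      \<open>Suc n * nat N\<close> keeps them positive, where \<open>f\<close> agrees with
      \<open>q\<close>.\<close>
    define s where "s n = nat (r mod N) + Suc n * nat N" for n
    have int_s: "int (s n) = r mod N + (1 + int n) * N" for n
      using P(1) by (simp add: s_def distrib_right)
    have "P (int (s n)) = P r" for n
    proof -
      have "int (s n) = r + (1 + int n - r div N) * N"
        using mult_div_mod_eq[of N r] int_s[of n] by (simp add: algebra_simps)
      then show ?thesis using P(2) by simp
    qed
    moreover have "int (s n) > 0" for n
      unfolding int_s using P(1) by (intro add_nonneg_pos) auto
    ultimately have fs: "f (int (s n)) = poly (P r) (real (s n))" for n
      using P(3)[of "int (s n)"] f by simp
    have "strict_mono s"
      using P(1) by (auto simp: s_def strict_mono_Suc_iff)
    then have s: "filterlim s at_top sequentially" by (rule filterlim_subseq)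
    have "(\<lambda>n. f (int (s n)) / real (s n) ^ d) \<longlonglongrightarrow> a"
      by (rule filterlim_compose[OF lim s])
    then have "(\<lambda>n. poly (P r) (real (s n)) / real (s n) ^ d) \<longlonglongrightarrow> a"
      by (simp add: fs)
    moreover have "filterlim (\<lambda>n. real (s n)) at_top sequentially"
      by (rule filterlim_compose[OF filterlim_real_sequentially s])
    ultimately show ?thesis using \<open>a \<noteq> 0\<close> by (intro poly_growth)
  qed
  have per: "periodic (\<lambda>t. coeff (P t) i)" for i
    unfolding periodic_def periodic_fun_simple_def
    using P(1) P(2)[of _ 1] by (intro exI[of _ N]) simp
  have ft: "f t = (\<Sum>i\<le>d. coeff (P t) i * of_int t ^ i)" if "t > 0" for t
    using f[OF that] P(3)[of t] deg[of t] by (simp add: poly_altdef)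
  have lead: "coeff (P t) d = a" for t using deg[of t] by auto
  show ?thesis
    unfolding quasipolynomial_with_leading_coeff_def quasipolynomial_coeffs_def
    by (rule exI[of _ "\<lambda>i t. coeff (P t) i"]) (use per ft lead \<open>a \<noteq> 0\<close> in simp)
qed

section \<open>Counting rulers\<close>

text \<open>Rulers stripped of their ends 0 and \<open>u\<close>. The largest interior marking can
  then serve as the end of a shorter ruler, which gives a recursion.\<close>

definition interior_markings :: "nat \<Rightarrow> int \<Rightarrow> int list set" where
  "interior_markings j u = {zs. length zs = j \<and> sorted_wrt (<) (0 # zs @ [u])}"

lemma interior_markings_0: "interior_markings 0 u = (if 0 < u then {[]} else {})"
  by (auto simp: interior_markings_def)

lemma interior_markings_Suc: "interior_markings (Suc j) u = (\<Union>x\<in>{0<..<u}. (\<lambda>zs. zs @ [x]) ` interior_markings j x)"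
proof (intro equalityI subsetI)
  fix zs assume zs: "zs \<in> interior_markings (Suc j) u"
  then have "zs \<noteq> []" by (auto simp: interior_markings_def)
  then obtain ws x where ws: "zs = ws @ [x]" by (metis rev_exhaust)
  have "x \<in> {0<..<u}" "ws \<in> interior_markings j x"
    using zs by (auto simp: interior_markings_def ws sorted_wrt_append)
  then show "zs \<in> (\<Union>x\<in>{0<..<u}. (\<lambda>zs. zs @ [x]) ` interior_markings j x)" using ws by auto
next
  fix zs assume "zs \<in> (\<Union>x\<in>{0<..<u}. (\<lambda>zs. zs @ [x]) ` interior_markings j x)"
  then show "zs \<in> interior_markings (Suc j) u"
    by (auto simp: interior_markings_def sorted_wrt_append) (meson less_trans)+
qed

lemma finite_interior_markings [simp]: "finite (interior_markings j u)"
  by (induction j arbitrary: u) (auto simp: interior_markings_0 interior_markings_Suc)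

lemma sum_interior_markings_Suc:
  "(\<Sum>zs\<in>interior_markings (Suc j) u. F zs) = (\<Sum>x\<in>{0<..<u}. \<Sum>zs\<in>interior_markings j x. F (zs @ [x]))"
  unfolding interior_markings_Suc
  by (subst sum.UNION_disjoint) (auto simp: sum.reindex inj_on_def)

lemma interior_markings_subset: "interior_markings j u \<subseteq> {zs. set zs \<subseteq> {0<..<u} \<and> length zs = j}"
  by (auto simp: interior_markings_def sorted_wrt_append)

text \<open>The recursion on the largest interior marking turns into the hockey-stick identity for
  binomial coefficients.\<close>

lemma card_interior_markings: "card (interior_markings j (int (Suc n))) = n choose j"
proof (induction j arbitrary: n)
  case (Suc j)
  have "card (interior_markings (Suc j) (int (Suc n))) = (\<Sum>x\<in>{0<..<int (Suc n)}. card (interior_markings j x))"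
    using sum_interior_markings_Suc[of "\<lambda>_. 1::nat" j "int (Suc n)"] by simp
  also have "\<dots> = (\<Sum>i<n. card (interior_markings j (int (Suc i))))"
    by (rule sum.reindex_bij_witness[of _ "\<lambda>i. int (Suc i)" "\<lambda>x. nat (x - 1)"]) auto
  also have "\<dots> = (\<Sum>i<n. i choose j)" by (simp only: Suc)
  also have "\<dots> = n choose Suc j"
    using sum_choose_upper[of j "n - 1"] by (cases n) (auto simp: lessThan_Suc_atMost)
  finally show ?case .
qed (simp add: interior_markings_0)

lemma rulers_eq_interior_markings:
  assumes "m \<ge> 1"
  shows "{xs. ruler m t xs} = (\<lambda>zs. 0 # zs @ [t]) ` interior_markings (m - 1) t"
proof (intro equalityI subsetI)
  fix xs assume "xs \<in> {xs. ruler m t xs}"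
  then have xs: "length xs = m + 1" "xs ! 0 = 0" "xs ! m = t" "sorted_wrt (<) xs"
    by (auto simp: ruler_def)
  obtain ys where ys: "xs = 0 # ys" using xs(1,2) by (cases xs) auto
  then have "ys \<noteq> []" using xs(1) assms by auto
  then obtain zs x where zs: "ys = zs @ [x]" by (metis rev_exhaust)
  have "x = t" using xs(1,3) assms by (auto simp: ys zs nth_append nth_Cons')
  then show "xs \<in> (\<lambda>zs. 0 # zs @ [t]) ` interior_markings (m - 1) t"
    using xs(1,4) by (auto simp: ys zs interior_markings_def)
next
  fix xs assume "xs \<in> (\<lambda>zs. 0 # zs @ [t]) ` interior_markings (m - 1) t"
  then show "xs \<in> {xs. ruler m t xs}"
    using assms by (auto simp: interior_markings_def ruler_def nth_append nth_Cons')
qed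

lemma card_rulers:
  assumes "m \<ge> 1"
  shows "real (card {xs. ruler m t xs \<and> G xs}) = (\<Sum>zs\<in>interior_markings (m - 1) t. of_bool (G (0 # zs @ [t])))"
proof -
  have "{xs. ruler m t xs \<and> G xs} = {xs \<in> (\<lambda>zs. 0 # zs @ [t]) ` interior_markings (m - 1) t. G xs}"
    using rulers_eq_interior_markings[OF assms, of t] by blast
  also have "\<dots> = (\<lambda>zs. 0 # zs @ [t]) ` {zs \<in> interior_markings (m - 1) t. G (0 # zs @ [t])}"
    by auto
  finally have "card {xs. ruler m t xs \<and> G xs} = card {zs \<in> interior_markings (m - 1) t. G (0 # zs @ [t])}"
    by (simp add: card_image inj_on_def)
  then show ?thesis by (simp add: Int_def)
qed

text \<open>The variables list the markings from the top: \<open>y 0\<close> is the length, and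
  \<open>y k\<close> lies just below \<open>y (k - 1)\<close>. Hence \<open>rev\<close> restores
  increasing order, and the variable with the highest index, which is the smallest marking, is
  summed out first.\<close>

lemma pw_quasipoly_sum_interior_markings:
  assumes "k \<ge> 1" "(\<lambda>y. F (0 # map y (rev [0..<k + j]))) \<in> pw_quasipoly (k + j)"
  shows "(\<lambda>y. \<Sum>zs\<in>interior_markings j (y (k - 1)). F (0 # zs @ map y (rev [0..<k]))) \<in> pw_quasipoly k"
  using assms
proof (induction j arbitrary: k)
  case 0
  have "(\<lambda>y. of_bool (0 < y (k - 1)) * F (0 # map y (rev [0..<k]))) \<in> pw_quasipoly k"
    using 0 by (intro pw_quasipoly.mult pw_quasipoly.pos linear_form_coordinate) auto
  moreover have "of_bool (0 < y (k - 1)) * F (0 # map y (rev [0..<k])) =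
      (\<Sum>zs\<in>interior_markings 0 (y (k - 1)). F (0 # zs @ map y (rev [0..<k])))" for y
    by (simp add: interior_markings_0)
  ultimately show ?case by simp
next
  case (Suc j)
  define h where "h y = (\<Sum>zs\<in>interior_markings j (y (Suc k - 1)). F (0 # zs @ map y (rev [0..<Suc k])))" for y
  have "h \<in> pw_quasipoly (Suc k)"
    using Suc.IH[of "Suc k"] Suc.prems unfolding h_def by simp
  then have "(\<lambda>y. \<Sum>x\<in>{0<..<y (k - 1)}. h (y(k := x))) \<in> pw_quasipoly k"
    by (rule pw_quasipoly_sum_update) (use Suc.prems in \<open>simp add: linear_form_coordinate\<close>)
  moreover have upd: "map (y(k := x)) (rev [0..<k]) = map y (rev [0..<k])" for y :: "nat \<Rightarrow> int" and x
    by simp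
  have "h (y(k := x)) = (\<Sum>zs\<in>interior_markings j x. F (0 # (zs @ [x]) @ map y (rev [0..<k])))" for y x
    by (simp add: h_def upd del: map_fun_upd)
  ultimately show ?case by (simp add: sum_interior_markings_Suc)
qed

text \<open>If an interior marking has a nonzero coefficient, the equation determines it from the
  others, so deleting it is injective. Otherwise the equation reads \<open>c m * t = 0\<close> and
  has no solution. The factor \<open>nat t\<close> on the left avoids the exponent
  \<open>m - 2\<close>, which would be truncated for \<open>m = 1\<close>.\<close>

lemma card_interior_markings_hyperplane:
  assumes "m \<ge> 1" "t > 0" "1 \<le> i" "i \<le> m" "c i \<noteq> 0"
  shows "card {zs \<in> interior_markings (m - 1) t. (\<Sum>i\<le>m. c i * (0 # zs @ [t]) ! i) = 0} * nat t \<le> nat t ^ (m - 1)"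
    (is "card ?Z * _ \<le> _")
proof (cases "\<exists>i. 1 \<le> i \<and> i < m \<and> c i \<noteq> 0")
  case True
  then obtain i where i: "1 \<le> i" "i < m" "c i \<noteq> 0" by auto
  \<comment> \<open>Marking \<open>i\<close> of the ruler is entry \<open>i - 1\<close> of
    \<open>zs\<close>, because of the leading 0; \<open>r\<close> deletes it.\<close>
  define r where "r zs = take (i - 1) zs @ drop i zs" for zs :: "int list"
  have len: "length zs = m - 1" if "zs \<in> ?Z" for zs using that by (simp add: interior_markings_def)
  have "inj_on r ?Z"
  proof (rule inj_onI)
    fix zs ws assume zs: "zs \<in> ?Z" and ws: "ws \<in> ?Z" and eq: "r zs = r ws"
    have tk: "take (i - 1) zs = take (i - 1) ws" and dr: "drop i zs = drop i ws"
      using eq len[OF zs] len[OF ws] i by (auto simp: r_def append_eq_append_conv)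
    have nth: "zs ! j = ws ! j" if "j < m - 1" "j \<noteq> i - 1" for j
    proof (cases "j < i - 1")
      case True
      then show ?thesis using tk by (metis nth_take)
    next
      case False
      then have "zs ! j = drop i zs ! (j - i)" "ws ! j = drop i ws ! (j - i)"
        using that i len[OF zs] len[OF ws] by auto
      then show ?thesis using dr by simp
    qed
    have other: "(0 # zs @ [t]) ! j = (0 # ws @ [t]) ! j" if "j \<le> m" "j \<noteq> i" for j
      using that nth[of "j - 1"] len[OF zs] len[OF ws] assms(1) i
      by (auto simp: nth_Cons' nth_append)
    have "(\<Sum>j\<le>m. c j * (0 # zs @ [t]) ! j) = (\<Sum>j\<le>m. c j * (0 # ws @ [t]) ! j)"
      using zs ws by simp
    moreover have "(\<Sum>j\<in>{..m} - {i}. c j * (0 # zs @ [t]) ! j) = (\<Sum>j\<in>{..m} - {i}. c j * (0 # ws @ [t]) ! j)"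
      by (rule sum.cong) (use other in auto)
    ultimately have "c i * (0 # zs @ [t]) ! i = c i * (0 # ws @ [t]) ! i"
      using i by (simp add: sum.remove[of "{..m}" i])
    then have "(0 # zs @ [t]) ! i = (0 # ws @ [t]) ! i" using i by simp
    then have "zs ! (i - 1) = ws ! (i - 1)"
      using i len[OF zs] len[OF ws] by (auto simp: nth_Cons' nth_append split: if_splits)
    then have "zs ! j = ws ! j" if "j < m - 1" for j using that nth by (cases "j = i - 1") auto
    then show "zs = ws" using len[OF zs] len[OF ws] by (intro nth_equalityI) auto
  qed
  then have "card ?Z = card (r ` ?Z)" by (simp add: card_image)
  also have "r ` ?Z \<subseteq> {zs. set zs \<subseteq> {0<..<t} \<and> length zs = m - 2}"
  proof (intro subsetI, elim imageE)
    fix ws zs assume ws: "ws = r zs" and zs: "zs \<in> ?Z"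
    have "set zs \<subseteq> {0<..<t}" using zs interior_markings_subset by blast
    then show "ws \<in> {zs. set zs \<subseteq> {0<..<t} \<and> length zs = m - 2}"
      using len[OF zs] i set_take_subset[of "i - 1" zs] set_drop_subset[of i zs]
      unfolding ws r_def by auto
  qed
  then have "card (r ` ?Z) \<le> card {zs. set zs \<subseteq> {0<..<t} \<and> length zs = m - 2}"
    by (intro card_mono finite_lists_length_eq) auto
  also have "\<dots> \<le> nat t ^ (m - 2)"
    by (simp add: card_lists_length_eq power_mono)
  finally have "card ?Z * nat t \<le> nat t ^ Suc (m - 2)" by simp
  also have "Suc (m - 2) = m - 1" using i by simp
  finally show ?thesis .
next
  case False
  then have "i = m" using assms(3-5) le_neq_implies_less by blast
  have "?Z = {}"
  proof (rule ccontr)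
    assume "?Z \<noteq> {}"
    then obtain zs where zs: "zs \<in> interior_markings (m - 1) t" "(\<Sum>i\<le>m. c i * (0 # zs @ [t]) ! i) = 0" by auto
    have "(0 # zs @ [t]) ! m = t"
      using zs(1) assms(1) by (auto simp: interior_markings_def nth_Cons' nth_append)
    moreover have "(\<Sum>i\<le>m. c i * (0 # zs @ [t]) ! i) = (\<Sum>i\<in>{m}. c i * (0 # zs @ [t]) ! i)"
      by (rule sum.mono_neutral_right) (use False in \<open>auto simp: nth_Cons'\<close>)
    ultimately show False using zs(2) assms(2,5) \<open>i = m\<close> by simp
  qed
  then show ?thesis by (simp only: card.empty)
qed

section \<open>Growth rates and the general counting theorem\<close>

lemma binomial_growth: "(\<lambda>n. real ((n - 1) choose k) / real n ^ k) \<longlonglongrightarrow> 1 / fact k"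
proof -
  have "(\<lambda>n. (\<Prod>i = 0..<k. 1 - (1 + real i) / real n) / fact k) \<longlonglongrightarrow> (\<Prod>i = 0..<k. 1 - 0) / fact k"
    by (intro tendsto_intros lim_const_over_n) auto
  moreover have "eventually (\<lambda>n. (\<Prod>i = 0..<k. 1 - (1 + real i) / real n) / fact k =
      real ((n - 1) choose k) / real n ^ k) sequentially"
    using eventually_gt_at_top[of 0]
  proof eventually_elim
    case (elim n)
    have "real ((n - 1) choose k) = (\<Prod>i = 0..<k. real (n - 1) - real i) / fact k"
      by (simp add: binomial_gbinomial gbinomial_prod_rev)
    also have "(\<Prod>i = 0..<k. real (n - 1) - real i) = (\<Prod>i = 0..<k. real n * (1 - (1 + real i) / real n))"
      using elim by (intro prod.cong) (auto simp: field_simps of_nat_diff)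
    also have "\<dots> = real n ^ k * (\<Prod>i = 0..<k. 1 - (1 + real i) / real n)"
      by (simp add: prod.distrib)
    finally show ?case using elim by simp
  qed
  ultimately show ?thesis by (auto intro: Lim_transform_eventually)
qed

text \<open>A bound for infinitely many values \<open>n\<close> becomes a finite Boolean combination
  of equations and inequalities between the \<open>s p\<close>: no \<open>Suc g\<close> elements
  share a positive value. The family of sets \<open>Y\<close> is independent of \<open>s\<close>,
  hence of the ruler.\<close>

lemma multiplicity_bound_iff:
  fixes s :: "'p \<Rightarrow> int"
  assumes "finite X"
  shows "(\<forall>n>0. card {p \<in> X. s p = n} \<le> g) \<longleftrightarrow>
    (\<forall>Y\<in>{Y. Y \<subseteq> X \<and> card Y = Suc g}. \<not> ((\<forall>p\<in>Y. \<forall>q\<in>Y. s p = s q) \<and> (\<forall>p\<in>Y. 0 < s p)))"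
proof (intro iffI ballI allI impI notI)
  fix Y assume *: "\<forall>n>0. card {p \<in> X. s p = n} \<le> g" and Y: "Y \<in> {Y. Y \<subseteq> X \<and> card Y = Suc g}"
    and s: "(\<forall>p\<in>Y. \<forall>q\<in>Y. s p = s q) \<and> (\<forall>p\<in>Y. 0 < s p)"
  have "Y \<noteq> {}" using Y by auto
  then obtain p where p: "p \<in> Y" by blast
  have "Y \<subseteq> {q \<in> X. s q = s p}" using Y s p by blast
  then have "card Y \<le> card {q \<in> X. s q = s p}" using assms by (intro card_mono) auto
  moreover have "card {q \<in> X. s q = s p} \<le> g" using * s p by blast
  ultimately show False using Y by simp
next
  fix n :: int
  assume *: "\<forall>Y\<in>{Y. Y \<subseteq> X \<and> card Y = Suc g}. \<not> ((\<forall>p\<in>Y. \<forall>q\<in>Y. s p = s q) \<and> (\<forall>p\<in>Y. 0 < s p))"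
    and "n > 0"
  show "card {p \<in> X. s p = n} \<le> g"
  proof (rule ccontr)
    assume "\<not> card {p \<in> X. s p = n} \<le> g"
    then have "Suc g \<le> card {p \<in> X. s p = n}" by simp
    then obtain Y where Y: "Y \<subseteq> {p \<in> X. s p = n}" "card Y = Suc g"
      by (rule obtain_subset_with_card_n)
    have s: "s p = n" if "p \<in> Y" for p using Y that by blast
    have "Y \<in> {Y. Y \<subseteq> X \<and> card Y = Suc g}" using Y by blast
    moreover have "(\<forall>p\<in>Y. \<forall>q\<in>Y. s p = s q) \<and> (\<forall>p\<in>Y. 0 < s p)"
      using s \<open>n > 0\<close> by simp
    ultimately show False using * by blast
  qed
qed

text \<open>The three kinds of rulers are all instances: \<open>C p\<close> is the coefficient vector of the sum or
  difference of markings that is indexed by \<open>p\<close>.\<close>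
theorem quasipolynomial_rulers:
  fixes C :: "'p \<Rightarrow> nat \<Rightarrow> int"
  assumes "m \<ge> 1" "g \<ge> 1" "finite X"
    and C: "\<And>p q. p \<in> X \<Longrightarrow> q \<in> X \<Longrightarrow> (\<And>i. 1 \<le> i \<Longrightarrow> i \<le> m \<Longrightarrow> C p i = C q i) \<Longrightarrow> p = q"
  shows "quasipolynomial_with_leading_coeff (m - 1) (1 / fact (m - 1)) (\<lambda>t. real (card
    {xs. ruler m t xs \<and> (\<forall>n>0. card {p \<in> X. (\<Sum>i\<le>m. C p i * xs ! i) = n} \<le> g)}))"
proof -
  define G where "G xs \<longleftrightarrow> (\<forall>n>0. card {p \<in> X. (\<Sum>i\<le>m. C p i * xs ! i) = n} \<le> g)" for xs
  define f where "f t = real (card {xs. ruler m t xs \<and> G xs})" for t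
  have f_sum: "f t = (\<Sum>zs\<in>interior_markings (m - 1) t. of_bool (G (0 # zs @ [t])))" for t
    unfolding f_def by (rule card_rulers[OF assms(1)])
  have lf: "linear_form m (\<lambda>y. \<Sum>i\<le>m. C p i * (0 # map y (rev [0..<m])) ! i)" for p
  proof -
    \<comment> \<open>Marking \<open>i \<ge> 1\<close> is the variable \<open>y (m - i)\<close>, and
      marking 0 contributes nothing, so the form is homogeneous.\<close>
    have "(\<Sum>i\<le>m. C p i * (0 # map y (rev [0..<m])) ! i) = (\<Sum>i<m. C p (m - i) * y i)" for y
    proof -
      have "(\<Sum>i\<le>m. C p i * (0 # map y (rev [0..<m])) ! i) = (\<Sum>i<m. C p (Suc i) * y (m - Suc i))"
        by (simp add: sum.atMost_shift rev_nth)
      also have "\<dots> = (\<Sum>i<m. C p (m - i) * y i)"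
        by (rule sum.reindex_bij_witness[of _ "\<lambda>i. m - Suc i" "\<lambda>i. m - Suc i"]) (auto simp: Suc_diff_Suc)
      finally show ?thesis .
    qed
    then show ?thesis by simp
  qed
  have "(\<lambda>y. of_bool (G (0 # map y (rev [0..<m])))) \<in> pw_quasipoly m"
  proof -
    have fin: "finite Y" if "Y \<in> {Y. Y \<subseteq> X \<and> card Y = Suc g}" for Y
      using that assms(3) finite_subset by blast
    have "finite {Y. Y \<subseteq> X \<and> card Y = Suc g}" using assms(3) by simp
    then show ?thesis
      unfolding G_def multiplicity_bound_iff[OF assms(3)]
      by (intro pw_quasipoly_ball pw_quasipoly_not pw_quasipoly_conj pw_quasipoly_eq pw_quasipoly_less linear_form_zero lf fin)
  qed
  then have "(\<lambda>y. \<Sum>zs\<in>interior_markings (m - 1) (y (1 - 1)). of_bool (G (0 # zs @ map y (rev [0..<1])))) \<in> pw_quasipoly 1"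
    using pw_quasipoly_sum_interior_markings[of 1 "\<lambda>xs. of_bool (G xs)" "m - 1"] assms(1) by simp
  from pw_quasipoly_one_quasipoly[OF this]
  have "\<exists>q. quasipoly q \<and> (\<forall>t>0. f t = q t)" by (simp add: f_sum)
  then obtain q where "quasipoly q \<and> (\<forall>t>0. f t = q t)" ..
  then have q: "quasipoly q" "\<And>t. t > 0 \<Longrightarrow> f t = q t" by auto
  \<comment> \<open>Since \<open>g \<ge> 1\<close>, an excluded ruler gives two distinct elements of
    \<open>X\<close> the same value, so it lies on one of at most \<open>K\<close> hyperplanes. Each
    contains at most \<open>n ^ (m - 1) / n\<close> rulers, whence the relative error
    \<open>K / n\<close>.\<close>
  define K where "K = real (card (X \<times> X))"
  have lower: "real ((n - 1) choose (m - 1)) / real n ^ (m - 1) - K / real n \<le> f (int n) / real n ^ (m - 1)"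
    and upper: "f (int n) / real n ^ (m - 1) \<le> real ((n - 1) choose (m - 1)) / real n ^ (m - 1)" if "n > 0" for n
  proof -
    let ?A = "interior_markings (m - 1) (int n)"
    let ?B = "{zs \<in> ?A. \<not> G (0 # zs @ [int n])}"
    define D where "D = (\<lambda>(p, q). {zs \<in> ?A. (\<Sum>i\<le>m. (C p i - C q i) * (0 # zs @ [int n]) ! i) = 0})"
    have card_A: "card ?A = (n - 1) choose (m - 1)"
      using card_interior_markings[of "m - 1" "n - 1"] that by simp
    have "f (int n) = card ?A - real (card ?B)"
    proof -
      have "card {zs \<in> ?A. G (0 # zs @ [int n])} + card ?B = card ?A"
        by (subst card_Un_disjoint[symmetric]) (auto intro!: arg_cong[of _ _ card])
      then show ?thesis by (simp add: f_sum Int_def flip: of_nat_add)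
    qed
    moreover have "card ?B * n \<le> card (X \<times> X) * n ^ (m - 1)"
    proof -
      define E where "E = {(p, q) \<in> X \<times> X. p \<noteq> q}"
      have "E \<subseteq> X \<times> X" by (auto simp: E_def)
      then have fin: "finite E" using assms(3) by (auto intro: finite_subset)
      have "?B \<subseteq> (\<Union>e\<in>E. D e)"
      proof
        fix zs assume zs: "zs \<in> ?B"
        define s where "s p = (\<Sum>i\<le>m. C p i * (0 # zs @ [int n]) ! i)" for p
        have "\<not> (\<forall>n>0. card {p \<in> X. s p = n} \<le> g)" using zs by (simp add: G_def s_def)
        then obtain k where "\<not> card {p \<in> X. s p = k} \<le> g" by blast
        then have "card {p \<in> X. s p = k} > 1" using assms(2) by linarith
        then obtain p q where "p \<in> X" "q \<in> X" "p \<noteq> q" "s p = s q"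
          using card_le_Suc0_iff_eq[of "{p \<in> X. s p = k}"] assms(3) by auto
        then show "zs \<in> (\<Union>e\<in>E. D e)"
          using zs by (auto simp: E_def D_def s_def left_diff_distrib sum_subtractf)
      qed
      then have "card ?B \<le> card (\<Union>e\<in>E. D e)"
        by (rule card_mono[rotated]) (use fin in \<open>auto simp: D_def\<close>)
      also have "\<dots> \<le> (\<Sum>e\<in>E. card (D e))" by (rule card_UN_le[OF fin])
      finally have "card ?B * n \<le> (\<Sum>e\<in>E. card (D e) * n)"
        by (simp add: sum_distrib_right[symmetric])
      also have "\<dots> \<le> (\<Sum>e\<in>E. n ^ (m - 1))"
      proof (rule sum_mono)
        fix e assume "e \<in> E"
        then obtain p q where e: "e = (p, q)" "p \<in> X" "q \<in> X" "p \<noteq> q" by (auto simp: E_def)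
        \<comment> \<open>The vectors differ at an index other than 0, so the equation is nontrivial
          even though marking 0 vanishes.\<close>
        then obtain i where "1 \<le> i" "i \<le> m" "C p i \<noteq> C q i" using C by blast
        then show "card (D e) * n \<le> n ^ (m - 1)"
          using card_interior_markings_hyperplane[OF assms(1), of "int n" i "\<lambda>i. C p i - C q i"] that
          by (simp add: e D_def)
      qed
      also have "\<dots> \<le> card (X \<times> X) * n ^ (m - 1)"
        using card_mono[OF _ \<open>E \<subseteq> X \<times> X\<close>] assms(3) by simp
      finally show ?thesis .
    qed
    then have "real (card ?B) * real n \<le> K * real n ^ (m - 1)"
      unfolding K_def by (simp only: flip: of_nat_mult of_nat_power of_nat_le_iff)
    then have "real (card ?B) / real n ^ (m - 1) \<le> K / real n"
      using that by (simp add: field_simps)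
    ultimately show "real ((n - 1) choose (m - 1)) / real n ^ (m - 1) - K / real n \<le> f (int n) / real n ^ (m - 1)"
      and "f (int n) / real n ^ (m - 1) \<le> real ((n - 1) choose (m - 1)) / real n ^ (m - 1)"
      unfolding card_A[symmetric] by (simp_all add: diff_divide_distrib divide_right_mono)
  qed
  have "(\<lambda>n. f (int n) / real n ^ (m - 1)) \<longlonglongrightarrow> 1 / fact (m - 1)"
  proof (rule tendsto_sandwich[OF _ _ _ binomial_growth])
    show "(\<lambda>n. real ((n - 1) choose (m - 1)) / real n ^ (m - 1) - K / real n) \<longlonglongrightarrow> 1 / fact (m - 1)"
      using tendsto_diff[OF binomial_growth lim_const_over_n[of K]] by simp
  qed (rule eventually_mono[OF eventually_gt_at_top[of 0]], rule lower upper, assumption)+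
  then have "quasipolynomial_with_leading_coeff (m - 1) (1 / fact (m - 1)) f"
    using quasipoly_leading_coeff[of q f "m - 1" "1 / fact (m - 1)"] q by simp
  then show ?thesis unfolding f_def G_def .
qed

section \<open>Sums and differences of markings as instances\<close>

lemma sum_count_list_mult:
  fixes v :: "nat \<Rightarrow> int"
  assumes "set rs \<subseteq> {..m}"
  shows "(\<Sum>i\<le>m. int (count_list rs i) * v i) = (\<Sum>r\<leftarrow>rs. v r)"
  using assms
proof (induction rs)
  case (Cons r rs)
  have "(\<Sum>i\<le>m. int (count_list (r # rs) i) * v i) =
      (\<Sum>i\<le>m. int (count_list rs i) * v i + (if i = r then v i else 0))"
    by (intro sum.cong) (auto simp: distrib_right)
  then show ?case using Cons by (simp add: sum.distrib)
qed simp

text \<open>The multiplicity of index 0 is recovered from the common length. Distinct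
  representations therefore differ in the multiplicity of a nonzero marking, as the general theorem
  demands of coefficient vectors.\<close>

lemma sorted_count_list_eqI:
  fixes rs ss :: "nat list"
  assumes "sorted rs" "sorted ss" "length rs = length ss" "set rs \<subseteq> {..m}" "set ss \<subseteq> {..m}"
    and eq: "\<And>i. 1 \<le> i \<Longrightarrow> i \<le> m \<Longrightarrow> count_list rs i = count_list ss i"
  shows "rs = ss"
proof -
  have "(\<Sum>i\<le>m. int (count_list rs i)) = (\<Sum>i\<le>m. int (count_list ss i))"
    using sum_count_list_mult[OF assms(4), of "\<lambda>_. 1"] sum_count_list_mult[OF assms(5), of "\<lambda>_. 1"] assms(3)
    by (simp add: sum_list_triv)
  moreover have "(\<Sum>i\<in>{..m} - {0}. int (count_list rs i)) = (\<Sum>i\<in>{..m} - {0}. int (count_list ss i))"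
    using eq by (intro sum.cong) auto
  ultimately have "count_list rs 0 = count_list ss 0"
    by (simp add: sum.remove[of "{..m}" 0])
  moreover have "count_list rs i = count_list ss i" if "i > m" for i
    using that assms(4,5) by (metis atMost_iff count_list_0_iff leD subsetD)
  ultimately have "count_list rs i = count_list ss i" for i
    using eq[of i] by (cases "i = 0"; cases "i \<le> m") auto
  then have "mset rs = mset ss" by (intro multiset_eqI) (simp add: count_mset)
  then show ?thesis using assms(1,2) by (metis sorted_sort_id properties_for_sort)
qed

text \<open>Covers both kinds of sums: \<open>h = 2\<close> gives the \<open>B_2[g]\<close>-sets,
  and \<open>g = 1\<close> gives the \<open>B_h\<close>-sets. The coefficient vector of a
  representation is its vector of multiplicities.\<close>

lemma quasipolynomial_sum_representations:
  assumes "m \<ge> 1" "g \<ge> 1"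
  shows "quasipolynomial_with_leading_coeff (m - 1) (1 / fact (m - 1)) (\<lambda>t. real (card
    {xs. ruler m t xs \<and> (\<forall>n>0. card (sum_representations h xs n) \<le> g)}))"
proof -
  define X where "X = {rs. length rs = h \<and> sorted rs \<and> set rs \<subseteq> {..m}}"
  have "finite X"
    by (rule finite_subset[OF _ finite_lists_length_eq[of "{..m}" h]]) (auto simp: X_def)
  moreover have "rs = ss" if "rs \<in> X" "ss \<in> X"
    "\<And>i. 1 \<le> i \<Longrightarrow> i \<le> m \<Longrightarrow> int (count_list rs i) = int (count_list ss i)" for rs ss
    using that by (intro sorted_count_list_eqI[of rs ss m]) (auto simp: X_def)
  moreover have "sum_representations h xs n = {rs \<in> X. (\<Sum>i\<le>m. int (count_list rs i) * xs ! i) = n}"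
    if "ruler m t xs" for t xs n
    using that
    by (auto simp: sum_representations_def X_def ruler_def lessThan_Suc_atMost sum_count_list_mult)
  then have "{xs. ruler m t xs \<and> (\<forall>n>0. card (sum_representations h xs n) \<le> g)} =
      {xs. ruler m t xs \<and> (\<forall>n>0. card {rs \<in> X. (\<Sum>i\<le>m. int (count_list rs i) * xs ! i) = n} \<le> g)}" for t
    by auto
  ultimately show ?thesis
    using quasipolynomial_rulers[OF assms, of X "\<lambda>rs i. int (count_list rs i)"] by simp
qed

lemma B2_set_iff: "B2_set g xs \<longleftrightarrow> (\<forall>n>0. card (sum_representations 2 xs n) \<le> g)"
proof -
  have "card (sum_representations 2 xs n) = card {(i, j). i \<le> j \<and> j < length xs \<and> xs ! i + xs ! j = n}" for n
  proof -
    have "sum_representations 2 xs n =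
        (\<lambda>(i, j). [i, j]) ` {(i, j). i \<le> j \<and> j < length xs \<and> xs ! i + xs ! j = n}"
      by (auto simp: sum_representations_def length_Suc_conv numeral_2_eq_2 image_iff)
    then show ?thesis by (simp add: card_image inj_on_def split_beta prod_eq_iff)
  qed
  then show ?thesis by (simp add: B2_set_def)
qed

lemma quasipolynomial_differences:
  assumes "m \<ge> 1" "g \<ge> 1"
  shows "quasipolynomial_with_leading_coeff (m - 1) (1 / fact (m - 1)) (\<lambda>t. real (b2_minus m g t))"
proof -
  define X where "X = {(i, j). i < j \<and> j \<le> m}"
  define C :: "nat \<times> nat \<Rightarrow> nat \<Rightarrow> int"
    where "C = (\<lambda>(i, j) k. of_bool (k = j) - of_bool (k = i))"
  have "finite X" by (rule finite_subset[of _ "{..m} \<times> {..m}"]) (auto simp: X_def)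
  moreover have "p = q" if p: "p \<in> X" and q: "q \<in> X"
    and eq: "\<And>k. 1 \<le> k \<Longrightarrow> k \<le> m \<Longrightarrow> C p k = C q k" for p q
  proof -
    obtain i j i' j' where pq: "p = (i, j)" "q = (i', j')" "i < j" "j \<le> m" "i' < j'" "j' \<le> m"
      using p q by (auto simp: X_def)
    have e: "of_bool (k = j) - of_bool (k = i) = (of_bool (k = j') - of_bool (k = i') :: int)"
      if "1 \<le> k" "k \<le> m" for k
      using eq[OF that] by (simp add: C_def pq(1,2))
    \<comment> \<open>The index \<open>j\<close> exceeds \<open>i\<close>, so it is at least 1 and
      visible as the position of the coefficient 1.\<close>
    have "j = j'" using e[of j] pq by (simp add: of_bool_def split: if_splits)
    moreover have "i = i'"
    proof (cases "i = 0")
      case True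
      \<comment> \<open>For \<open>i = 0\<close> the coefficient -1 is at no index from 1 to
        \<open>m\<close>, which excludes a positive \<open>i'\<close>.\<close>
      then show ?thesis using e[of i'] pq by (cases "i' = 0") (simp_all add: Suc_le_eq of_bool_def split: if_splits)
    next
      case False
      then show ?thesis using e[of i] pq by (simp add: of_bool_def split: if_splits)
    qed
    ultimately show ?thesis using pq by simp
  qed
  moreover have "{(i, j). i < j \<and> j < length xs \<and> xs ! j - xs ! i = n} =
      {p \<in> X. (\<Sum>i\<le>m. C p i * xs ! i) = n}" if "ruler m t xs" for t xs n
  proof -
    have "(\<Sum>k\<le>m. C (i, j) k * xs ! k) = xs ! j - xs ! i" if "i < j" "j \<le> m" for i j
    proof -
      have "(\<Sum>k\<le>m. C (i, j) k * xs ! k) = (\<Sum>k\<le>m. (if k = j then xs ! k else 0) - (if k = i then xs ! k else 0))"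
        by (intro sum.cong) (auto simp: C_def)
      also have "\<dots> = xs ! j - xs ! i" using that by (simp add: sum_subtractf)
      finally show ?thesis .
    qed
    moreover have "length xs = Suc m" using that by (simp add: ruler_def)
    ultimately show ?thesis by (auto simp: X_def less_Suc_eq_le)
  qed
  then have "{xs. ruler m t xs \<and> B2_minus_set g xs} =
      {xs. ruler m t xs \<and> (\<forall>n>0. card {p \<in> X. (\<Sum>i\<le>m. C p i * xs ! i) = n} \<le> g)}" for t
    by (auto simp: B2_minus_set_def)
  ultimately show ?thesis
    using quasipolynomial_rulers[OF assms, of X C] by (simp add: b2_minus_def)
qed

theorem theorem2p3:
  fixes m h g :: nat
  assumes "m \<ge> 1" and "h \<ge> 2" and "g \<ge> 2"
  shows "quasipolynomial_with_leading_coeff (m - 1) (1 / fact (m - 1)) (\<lambda>t. real (b2 m g t)) \<and>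
         quasipolynomial_with_leading_coeff (m - 1) (1 / fact (m - 1)) (\<lambda>t. real (b2_minus m g t)) \<and>
         quasipolynomial_with_leading_coeff (m - 1) (1 / fact (m - 1)) (\<lambda>t. real (bh m h t))"
  using quasipolynomial_sum_representations[of m g 2] quasipolynomial_differences[of m g]
    quasipolynomial_sum_representations[of m 1 h] assms
  by (simp add: b2_def bh_def B2_set_iff Bh_set_def)

end
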